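(* Let $0<\alpha<10^{-5}$ and let $G$ be an $n$-vertex graph satisfying $$\lambda(G)\ge\left(\frac12-\alpha\right)n.$$ Then one of the following holds: (a) $G$ contains a book of size $\operatorname{bk}(G)>\left(\frac16-2\alpha^{1/3}\right)n$; (b) $G$ contains an induced bipartite subgraph $H$ such that $|H|\ge\left(1-\alpha^{1/3}\right)n$ and $\delta(H)\ge\left(\frac12-4\alpha^{1/3}\right)n$.
   Context: Graphs are finite and simple. $\lambda(G)$ is the spectral radius of the adjacency matrix of $G$. The booksize is $\operatorname{bk}(G)=\max_{uv\in E(G)}|N(u)\cap N(v)|$, the maximum number of triangles sharing a common edge. $|H|$ denotes the number of vertices of $H$ and $\delta(H)$ its minimum degree. *)

theory Defs
  imports
    "Graph_Theory.Graph_Theory"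
    "Jordan_Normal_Form.Spectral_Radius"
begin

text \<open>
  A finite simple graph is a \<^term>\<open>G :: 'a pair_pre_digraph\<close> with \<^term>\<open>pair_graph G\<close>: a finite
  digraph whose arc relation is irreflexive and symmetric. An undirected edge \<open>uv\<close> is thus
  represented by the two arcs \<open>(u, v)\<close> and \<open>(v, u)\<close>.
\<close>

definition nbhd :: "'a pair_pre_digraph \<Rightarrow> 'a \<Rightarrow> 'a set" where
  "nbhd G v = {w \<in> pverts G. (v, w) \<in> parcs G}"

text \<open>An edgeless graph has no books; its booksize is 0 by convention.\<close>

definition booksize :: "'a pair_pre_digraph \<Rightarrow> nat" where
  "booksize G =
     (if parcs G = {} then 0 else Max ((\<lambda>(u, v). card (nbhd G u \<inter> nbhd G v)) ` parcs G))"

text \<open>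
  As the arc relation is symmetric, the out-degree is the degree of the undirected graph.
  The graph without vertices has minimum degree 0 by convention.
\<close>

definition min_degree :: "'a pair_pre_digraph \<Rightarrow> nat" where
  "min_degree G =
     (if pverts G = {} then 0 else Min (out_degree (with_proj G) ` pverts G))"

definition bipartite :: "'a pair_pre_digraph \<Rightarrow> bool" where
  "bipartite G \<longleftrightarrow> (\<exists>A B. A \<union> B = pverts G \<and> A \<inter> B = {} \<and>
     (\<forall>(u, v) \<in> parcs G. u \<in> A \<and> v \<in> B \<or> u \<in> B \<and> v \<in> A))"

definition adjacency_matrix :: "'a pair_pre_digraph \<Rightarrow> 'a list \<Rightarrow> complex mat" where
  "adjacency_matrix G vs = Matrix.mat (length vs) (length vs)
     (\<lambda>(i, j). if (vs ! i, vs ! j) \<in> parcs G then 1 else 0)"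

text \<open>
  The rows and columns are ordered by an arbitrary enumeration of the vertices; the choice is
  irrelevant by \<open>graph_spectral_radius_eq\<close> below.
\<close>

definition graph_spectral_radius :: "'a pair_pre_digraph \<Rightarrow> real" where
  "graph_spectral_radius G =
     spectral_radius (adjacency_matrix G (SOME vs. distinct vs \<and> set vs = pverts G))"

lemma eigenvalue_adjacency_matrix_iff:
  assumes vs: "distinct vs" "set vs = pverts G"
  shows "eigenvalue (adjacency_matrix G vs) k \<longleftrightarrow>
    (\<exists>f. (\<exists>x\<in>pverts G. f x \<noteq> 0) \<and> (\<forall>x\<in>pverts G. (\<Sum>y\<in>nbhd G x. f y) = k * f x))"
    (is "?L \<longleftrightarrow> ?R")
proof -
  let ?n = "length vs" and ?A = "adjacency_matrix G vs"
  have dim: "dim_row ?A = ?n" "dim_col ?A = ?n" by (simp_all add: adjacency_matrix_def)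
  have bij: "bij_betw ((!) vs) {0..<?n} (pverts G)"
    using bij_betw_nth[OF vs(1)] vs(2) by (simp add: atLeast0LessThan)
  have fin: "finite (pverts G)" unfolding vs(2)[symmetric] by simp
  have row: "(?A *\<^sub>v v) $ i = (\<Sum>y\<in>nbhd G (vs ! i). f y)"
    if v: "v \<in> carrier_vec ?n" and f: "\<And>j. j < ?n \<Longrightarrow> v $ j = f (vs ! j)" and i: "i < ?n" for v f i
  proof -
    have "(?A *\<^sub>v v) $ i = (\<Sum>j = 0..<?n. (if (vs ! i, vs ! j) \<in> parcs G then f (vs ! j) else 0))"
      using v i f by (auto simp: adjacency_matrix_def scalar_prod_def intro!: sum.cong)
    also have "\<dots> = (\<Sum>y\<in>pverts G. if (vs ! i, y) \<in> parcs G then f y else 0)"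
      by (rule sum.reindex_bij_betw[OF bij])
    also have "\<dots> = (\<Sum>y\<in>nbhd G (vs ! i). f y)"
      using fin by (simp add: nbhd_def sum.inter_filter)
    finally show ?thesis .
  qed
  show ?thesis
  proof
    assume ?L
    then obtain v where v: "v \<in> carrier_vec ?n" "v \<noteq> 0\<^sub>v ?n" "?A *\<^sub>v v = k \<cdot>\<^sub>v v"
      by (auto simp: eigenvalue_def eigenvector_def dim)
    define f where "f x = v $ (inv_into {0..<?n} ((!) vs) x)" for x
    have f: "v $ j = f (vs ! j)" if "j < ?n" for j
      using bij_betw_inv_into_left[OF bij, of j] that by (simp add: f_def)
    obtain i where i: "i < ?n" "v $ i \<noteq> 0"
      using v(1,2) by (auto simp: vec_eq_iff)
    have "\<exists>x\<in>pverts G. f x \<noteq> 0"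
      using i f[of i] vs(2) nth_mem[of i vs] by auto
    moreover have "(\<Sum>y\<in>nbhd G x. f y) = k * f x" if x: "x \<in> pverts G" for x
    proof -
      obtain i where i: "i < ?n" "x = vs ! i"
        using x unfolding vs(2)[symmetric] in_set_conv_nth by blast
      have "(k \<cdot>\<^sub>v v) $ i = k * f x" using i f[OF i(1)] v(1) by simp
      moreover have "(?A *\<^sub>v v) $ i = (\<Sum>y\<in>nbhd G (vs ! i). f y)"
        by (rule row[where f = f]) (use v(1) f i(1) in auto)
      ultimately show ?thesis unfolding v(3) i(2) by (rule trans[OF sym, rotated])
    qed
    ultimately show ?R by blast
  next
    assume ?R
    then obtain f where f: "\<exists>x\<in>pverts G. f x \<noteq> 0"
      "\<And>x. x \<in> pverts G \<Longrightarrow> (\<Sum>y\<in>nbhd G x. f y) = k * f x" by blast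
    define v where "v = Matrix.vec ?n (\<lambda>i. f (vs ! i))"
    have v: "v \<in> carrier_vec ?n" "\<And>j. j < ?n \<Longrightarrow> v $ j = f (vs ! j)" by (auto simp: v_def)
    obtain i where "i < ?n" "f (vs ! i) \<noteq> 0"
      using f(1) unfolding vs(2)[symmetric] by (auto simp: in_set_conv_nth)
    hence "v \<noteq> 0\<^sub>v ?n" using v(2)[of i] by auto
    moreover have "?A *\<^sub>v v = k \<cdot>\<^sub>v v"
    proof (rule eq_vecI)
      fix i assume "i < dim_vec (k \<cdot>\<^sub>v v)"
      hence i: "i < ?n" using v(1) by simp
      hence "vs ! i \<in> pverts G" unfolding vs(2)[symmetric] by (rule nth_mem)
      hence "(\<Sum>y\<in>nbhd G (vs ! i). f y) = k * f (vs ! i)" by (rule f(2))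
      moreover have "(?A *\<^sub>v v) $ i = (\<Sum>y\<in>nbhd G (vs ! i). f y)"
        by (rule row[where f = f]) (use v i in auto)
      moreover have "(k \<cdot>\<^sub>v v) $ i = k * f (vs ! i)" using v i by simp
      ultimately show "(?A *\<^sub>v v) $ i = (k \<cdot>\<^sub>v v) $ i" by (simp only:)
    qed (use v(1) in \<open>simp add: dim\<close>)
    ultimately show ?L using v(1) by (auto simp: eigenvalue_def eigenvector_def dim)
  qed
qed

lemma graph_spectral_radius_eq:
  assumes "distinct vs" "set vs = pverts G"
  shows "graph_spectral_radius G = spectral_radius (adjacency_matrix G vs)"
proof -
  let ?ws = "SOME vs. distinct vs \<and> set vs = pverts G"
  have "distinct ?ws \<and> set ?ws = pverts G" by (rule someI[where x = vs]) (simp add: assms)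
  hence ws: "distinct ?ws" "set ?ws = pverts G" by blast+
  have "eigenvalue (adjacency_matrix G ?ws) = eigenvalue (adjacency_matrix G vs)"
    by (rule ext, rule trans[OF eigenvalue_adjacency_matrix_iff[OF ws]
          eigenvalue_adjacency_matrix_iff[OF assms, symmetric]])
  thus ?thesis unfolding graph_spectral_radius_def spectral_radius_def spectrum_def by (rule arg_cong)
qed

end

theory Submission
  imports Defs
begin

text \<open>
  Let \<open>g\<close> be a nonnegative vertex weight of total mass \<open>X\<close>, let \<open>D\<close> and \<open>c\<^sub>g\<close> be the weighted
  degrees and codegrees, \<open>c\<close> the plain codegree, and \<open>c \<le> b\<close> on every edge. Every edge satisfies
  \<open>D u + D v - X \<le> c\<^sub>g u v\<close>, and every triangle satisfies the analogous inequality for the sum of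
  its three weighted codegrees. Adding the former with weight \<open>b - c\<close> to twice the latter gives
  \<open>0 \<le> \<Sum>(b (c\<^sub>g - D u - D v + X) + c c\<^sub>g - X c / 3)\<close>, summed over the edges.

  With \<open>g\<close> the modulus of an eigenvector for the spectral radius \<open>\<lambda> \<ge> 3 b\<close> this shows that there
  are at least \<open>\<lambda>\<^sup>2\<close> edges. With \<open>g = 1\<close> and \<open>b \<le> n / 6\<close> it bounds the sum of the squared
  degrees, so that the squared deviations of the degrees from \<open>n / 2\<close> sum up to at most
  \<open>\<alpha> n\<^sup>3\<close>. Hence all but \<open>\<alpha>\<^bsup>1/3\<^esup> n\<close> vertices have degree at least
  \<open>(1 / 2 - \<alpha>\<^bsup>1/3\<^esup>) n\<close>; a triangle among them would contain an edge in too large a book, and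
  a triangle-free graph with such large minimum degree is bipartite.
\<close>

section \<open>Weighted degrees and codegrees in a finite symmetric relation\<close>

locale finite_symmetric_relation =
  fixes V :: "'a set" and E :: "'a \<Rightarrow> 'a \<Rightarrow> bool"
  assumes finite_V: "finite V"
    and sym: "E u v \<Longrightarrow> E v u"
begin

definition adj :: "'a \<Rightarrow> 'a \<Rightarrow> real" where
  "adj u v = of_bool (E u v)"

definition wdeg :: "('a \<Rightarrow> real) \<Rightarrow> 'a \<Rightarrow> real" where
  "wdeg g u = (\<Sum>w\<in>V. g w * adj u w)"

definition wcodeg :: "('a \<Rightarrow> real) \<Rightarrow> 'a \<Rightarrow> 'a \<Rightarrow> real" where
  "wcodeg g u v = (\<Sum>w\<in>V. g w * (adj u w * adj v w))"

abbreviation deg :: "'a \<Rightarrow> real" where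
  "deg \<equiv> wdeg (\<lambda>_. 1)"

abbreviation codeg :: "'a \<Rightarrow> 'a \<Rightarrow> real" where
  "codeg \<equiv> wcodeg (\<lambda>_. 1)"

lemma adj_commute: "adj u v = adj v u"
  unfolding adj_def using sym by (auto simp: of_bool_def)

lemma adj_nonneg: "0 \<le> adj u v"
  by (simp add: adj_def)

lemma wcodeg_nonneg:
  assumes "\<And>v. v \<in> V \<Longrightarrow> 0 \<le> g v"
  shows "0 \<le> wcodeg g u v"
  unfolding wcodeg_def using assms by (auto intro!: sum_nonneg mult_nonneg_nonneg adj_nonneg)

text \<open>The right-hand side is the total weight of the vertices adjacent to neither
  \<open>u\<close> nor \<open>v\<close>.\<close>

lemma wcodeg_ge:
  assumes "\<And>v. v \<in> V \<Longrightarrow> 0 \<le> g v"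
  shows "0 \<le> wcodeg g u v - wdeg g u - wdeg g v + sum g V"
proof -
  have "wcodeg g u v - wdeg g u - wdeg g v + sum g V =
      (\<Sum>w\<in>V. g w * ((1 - adj u w) * (1 - adj v w)))"
    by (simp add: wcodeg_def wdeg_def algebra_simps sum.distrib sum_subtractf)
  also have "\<dots> \<ge> 0"
    using assms by (intro sum_nonneg mult_nonneg_nonneg) (auto simp: adj_def)
  finally show ?thesis .
qed

text \<open>A vertex adjacent to exactly \<open>k\<close> of \<open>u\<close>, \<open>v\<close>,
  \<open>w\<close> contributes its weight times \<open>(k - 1) * (k - 2) / 2\<close>, which is
  nonnegative for every integer \<open>k\<close>.\<close>

lemma wcodeg_triple_ge:
  assumes "\<And>v. v \<in> V \<Longrightarrow> 0 \<le> g v"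
  shows "0 \<le> wcodeg g u v + wcodeg g v w + wcodeg g u w - wdeg g u - wdeg g v - wdeg g w + sum g V"
proof -
  have "wcodeg g u v + wcodeg g v w + wcodeg g u w - wdeg g u - wdeg g v - wdeg g w + sum g V =
      (\<Sum>z\<in>V. g z * (adj u z * adj v z + adj v z * adj w z + adj u z * adj w z
         - adj u z - adj v z - adj w z + 1))"
    by (simp add: wcodeg_def wdeg_def algebra_simps sum.distrib sum_subtractf)
  also have "\<dots> \<ge> 0"
    using assms by (intro sum_nonneg mult_nonneg_nonneg) (auto simp: adj_def)
  finally show ?thesis .
qed

section \<open>Sums over ordered triangles\<close>

definition triple_sum :: "('a \<Rightarrow> 'a \<Rightarrow> 'a \<Rightarrow> real) \<Rightarrow> real" where
  "triple_sum F = (\<Sum>u\<in>V. \<Sum>v\<in>V. \<Sum>w\<in>V. adj u v * adj u w * adj v w * F u v w)"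

text \<open>The adjacency factor is symmetric in the three vertices, so the arguments of
  \<open>F\<close> may be permuted; this swap and the next generate all permutations.\<close>

lemma triple_sum_swap12: "triple_sum F = triple_sum (\<lambda>u v w. F v u w)"
proof -
  have "triple_sum F = (\<Sum>v\<in>V. \<Sum>u\<in>V. \<Sum>w\<in>V. adj u v * adj u w * adj v w * F u v w)"
    unfolding triple_sum_def by (rule sum.swap)
  also have "\<dots> = triple_sum (\<lambda>u v w. F v u w)"
    unfolding triple_sum_def
    by (intro sum.cong refl) (metis adj_commute mult.commute mult.left_commute)
  finally show ?thesis .
qed

lemma triple_sum_swap23: "triple_sum F = triple_sum (\<lambda>u v w. F u w v)"
proof -
  have "triple_sum F = (\<Sum>u\<in>V. \<Sum>w\<in>V. \<Sum>v\<in>V. adj u v * adj u w * adj v w * F u v w)"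
    unfolding triple_sum_def by (rule sum.cong[OF refl], rule sum.swap)
  also have "\<dots> = triple_sum (\<lambda>u v w. F u w v)"
    unfolding triple_sum_def
    by (intro sum.cong refl) (metis adj_commute mult.commute mult.left_commute)
  finally show ?thesis .
qed

lemma triple_sum_add: "triple_sum (\<lambda>u v w. F u v w + F' u v w) = triple_sum F + triple_sum F'"
  by (simp add: triple_sum_def algebra_simps sum.distrib)

lemma triple_sum_cmult: "triple_sum (\<lambda>u v w. k * F u v w) = k * triple_sum F"
  by (simp add: triple_sum_def algebra_simps sum_distrib_left)

lemma triple_sum_edge:
  "triple_sum (\<lambda>u v w. F u v) = (\<Sum>u\<in>V. \<Sum>v\<in>V. adj u v * (codeg u v * F u v))"
  unfolding triple_sum_def wcodeg_def
  by (intro sum.cong refl) (simp add: sum_distrib_left sum_distrib_right mult_ac)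

lemma triple_sum_apex:
  "triple_sum (\<lambda>u v w. g w) = (\<Sum>u\<in>V. \<Sum>v\<in>V. adj u v * wcodeg g u v)"
  unfolding triple_sum_def wcodeg_def
  by (intro sum.cong refl) (simp add: sum_distrib_left mult_ac)

text \<open>Sum \<open>wcodeg_triple_ge\<close> over all ordered triangles. By symmetry the three
  codegree terms agree, and so do the three degree terms; summing out the third vertex then produces
  the factors \<open>codeg u v\<close>.\<close>

lemma triangle_sum_ge:
  assumes g: "\<And>v. v \<in> V \<Longrightarrow> 0 \<le> g v"
  shows "0 \<le> 3 * (\<Sum>u\<in>V. \<Sum>v\<in>V. adj u v * (codeg u v * wcodeg g u v))
    - 3 * triple_sum (\<lambda>u v w. wdeg g u) + sum g V * (\<Sum>u\<in>V. \<Sum>v\<in>V. adj u v * codeg u v)"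
proof -
  have "0 \<le> triple_sum (\<lambda>u v w. wcodeg g u v + wcodeg g v w + wcodeg g u w
      + (- 1) * wdeg g u + (- 1) * wdeg g v + (- 1) * wdeg g w + sum g V * 1)"
    unfolding triple_sum_def
    using wcodeg_triple_ge[OF g] by (intro sum_nonneg mult_nonneg_nonneg adj_nonneg) (simp add: algebra_simps)
  also have "\<dots> = triple_sum (\<lambda>u v w. wcodeg g u v) + triple_sum (\<lambda>u v w. wcodeg g v w)
      + triple_sum (\<lambda>u v w. wcodeg g u w) - triple_sum (\<lambda>u v w. wdeg g u)
      - triple_sum (\<lambda>u v w. wdeg g v) - triple_sum (\<lambda>u v w. wdeg g w)
      + sum g V * triple_sum (\<lambda>u v w. 1)"
    by (simp only: triple_sum_add triple_sum_cmult)
  also have "triple_sum (\<lambda>u v w. wcodeg g u w) = triple_sum (\<lambda>u v w. wcodeg g u v)"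
    by (rule triple_sum_swap23)
  also have "triple_sum (\<lambda>u v w. wcodeg g v w) = triple_sum (\<lambda>u v w. wcodeg g u w)"
    by (rule triple_sum_swap12)
  also have "triple_sum (\<lambda>u v w. wcodeg g u w) = triple_sum (\<lambda>u v w. wcodeg g u v)"
    by (rule triple_sum_swap23)
  also have "triple_sum (\<lambda>u v w. wdeg g w) = triple_sum (\<lambda>u v w. wdeg g v)"
    by (rule triple_sum_swap23)
  also have "triple_sum (\<lambda>u v w. wdeg g v) = triple_sum (\<lambda>u v w. wdeg g u)"
    by (rule triple_sum_swap12)
  finally show ?thesis
    by (simp add: triple_sum_edge)
qed

section \<open>The book inequality and its two consequences\<close>

lemma book_inequality:
  assumes g: "\<And>v. v \<in> V \<Longrightarrow> 0 \<le> g v"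
    and b: "\<And>u v. u \<in> V \<Longrightarrow> v \<in> V \<Longrightarrow> E u v \<Longrightarrow> codeg u v \<le> b"
  shows "0 \<le> (\<Sum>u\<in>V. \<Sum>v\<in>V. adj u v *
    (b * (wcodeg g u v - wdeg g u - wdeg g v + sum g V)
      + codeg u v * wcodeg g u v - sum g V * codeg u v / 3))"
proof -
  define X where "X = sum g V"
  have "0 \<le> (\<Sum>u\<in>V. \<Sum>v\<in>V. adj u v *
      ((b - codeg u v) * (wcodeg g u v - wdeg g u - wdeg g v + X)))"
    unfolding X_def
  proof (intro sum_nonneg)
    fix u v assume "u \<in> V" "v \<in> V"
    then show "0 \<le> adj u v * ((b - codeg u v) * (wcodeg g u v - wdeg g u - wdeg g v + sum g V))"
      using b wcodeg_ge[of g u v, OF g] by (auto simp: adj_def)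
  qed
  \<comment> \<open>This is \<open>2 / 3\<close> of \<open>triangle_sum_ge\<close>. Splitting its
    degree term evenly between the ends of the edge makes it cancel the products of codegrees and
    degrees in the previous sum.\<close>
  moreover have "0 \<le> 2 * (\<Sum>u\<in>V. \<Sum>v\<in>V. adj u v * (codeg u v * wcodeg g u v))
      - (\<Sum>u\<in>V. \<Sum>v\<in>V. adj u v * (codeg u v * wdeg g u))
      - (\<Sum>u\<in>V. \<Sum>v\<in>V. adj u v * (codeg u v * wdeg g v))
      + 2 / 3 * X * (\<Sum>u\<in>V. \<Sum>v\<in>V. adj u v * codeg u v)"
    using triangle_sum_ge[of g, OF g] triple_sum_swap12[of "\<lambda>u v w. wdeg g u"]
    unfolding triple_sum_edge X_def by simp
  moreover have "(\<Sum>u\<in>V. \<Sum>v\<in>V. adj u v *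
      ((b - codeg u v) * (wcodeg g u v - wdeg g u - wdeg g v + X)))
      + (2 * (\<Sum>u\<in>V. \<Sum>v\<in>V. adj u v * (codeg u v * wcodeg g u v))
      - (\<Sum>u\<in>V. \<Sum>v\<in>V. adj u v * (codeg u v * wdeg g u))
      - (\<Sum>u\<in>V. \<Sum>v\<in>V. adj u v * (codeg u v * wdeg g v))
      + 2 / 3 * X * (\<Sum>u\<in>V. \<Sum>v\<in>V. adj u v * codeg u v))
    = (\<Sum>u\<in>V. \<Sum>v\<in>V. adj u v * (b * (wcodeg g u v - wdeg g u - wdeg g v + X)
      + codeg u v * wcodeg g u v - X * codeg u v / 3))"
    unfolding sum_distrib_left sum.distrib[symmetric] sum_subtractf[symmetric]
    by (intro sum.cong refl) (simp add: field_simps)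
  ultimately show ?thesis unfolding X_def by linarith
qed

lemma sum_adj: "(\<Sum>u\<in>V. \<Sum>v\<in>V. adj u v * F u) = (\<Sum>u\<in>V. deg u * F u)"
  by (simp add: wdeg_def sum_distrib_right)

lemma sum_adj': "(\<Sum>u\<in>V. \<Sum>v\<in>V. adj u v * F v) = (\<Sum>u\<in>V. deg u * F u)"
proof -
  have "(\<Sum>u\<in>V. \<Sum>v\<in>V. adj u v * F v) = (\<Sum>v\<in>V. \<Sum>u\<in>V. adj v u * F v)"
    by (subst sum.swap) (intro sum.cong refl arg_cong2[of _ _ _ _ "(*)"] adj_commute)
  thus ?thesis by (simp add: sum_adj)
qed

text \<open>Self-adjointness of the adjacency operator \<open>wdeg\<close>, tested on
  \<open>g\<close> and the constant 1.\<close>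

lemma sum_deg_mult: "(\<Sum>u\<in>V. deg u * g u) = (\<Sum>u\<in>V. wdeg g u)"
  unfolding sum_adj'[symmetric] by (simp add: wdeg_def mult.commute)

text \<open>The hypothesis on \<open>r\<close> is the eigenvector equation weakened to an
  inequality. Triangles enter twice: through \<open>book_inequality\<close>, and through a bound on
  \<open>S\<close> that removes all codegree terms from it.\<close>

lemma edges_ge_square:
  assumes g: "\<And>v. v \<in> V \<Longrightarrow> 0 \<le> g v" and pos: "0 < sum g V"
    and b: "\<And>u v. u \<in> V \<Longrightarrow> v \<in> V \<Longrightarrow> E u v \<Longrightarrow> codeg u v \<le> b"
    and b0: "0 < b" and br: "3 * b \<le> r"
    and r: "\<And>v. v \<in> V \<Longrightarrow> r * g v \<le> wdeg g v"
  shows "2 * r\<^sup>2 \<le> (\<Sum>u\<in>V. deg u)"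
proof -
  define X where "X = sum g V"
  define S where "S = (\<Sum>u\<in>V. \<Sum>v\<in>V. adj u v * wcodeg g u v)"
  define C where "C = (\<Sum>u\<in>V. \<Sum>v\<in>V. adj u v * codeg u v)"
  define P where "P = (\<Sum>u\<in>V. \<Sum>v\<in>V. adj u v * (codeg u v * wcodeg g u v))"
  have r0: "0 < r" using b0 br by simp
  have S0: "0 \<le> S"
    unfolding S_def by (intro sum_nonneg mult_nonneg_nonneg adj_nonneg wcodeg_nonneg g)
  have P: "P \<le> b * S"
    unfolding P_def S_def sum_distrib_left
  proof (intro sum_mono)
    fix u v assume "u \<in> V" "v \<in> V"
    then show "adj u v * (codeg u v * wcodeg g u v) \<le> b * (adj u v * wcodeg g u v)"
      using b wcodeg_nonneg[of g u v, OF g] by (auto simp: adj_def intro: mult_right_mono)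
  qed
  \<comment> \<open>\<open>S\<close> is the weight of the third vertex summed over ordered
    triangles. Moving it to the first vertex allows the hypothesis on \<open>r\<close> to be applied
    there.\<close>
  have "r * S = triple_sum (\<lambda>u v w. r * g u)"
  proof -
    have "S = triple_sum (\<lambda>u v w. g v)"
      unfolding S_def triple_sum_apex[symmetric] by (rule triple_sum_swap23)
    also have "\<dots> = triple_sum (\<lambda>u v w. g u)" by (rule triple_sum_swap12)
    finally show ?thesis by (simp add: triple_sum_cmult)
  qed
  also have "\<dots> \<le> triple_sum (\<lambda>u v w. wdeg g u)"
    unfolding triple_sum_def by (intro sum_mono mult_left_mono r mult_nonneg_nonneg adj_nonneg)
  finally have tri: "(r - b) * S \<le> X * C / 3"
    using triangle_sum_ge[of g, OF g, folded X_def] P unfolding P_def[symmetric] C_def[symmetric]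
    by (simp add: algebra_simps)
  have wd: "r\<^sup>2 * X \<le> (\<Sum>u\<in>V. deg u * wdeg g u)"
  proof -
    have "r\<^sup>2 * X = r * (\<Sum>u\<in>V. r * g u)"
      by (simp add: X_def power2_eq_square sum_distrib_left mult_ac)
    also have "\<dots> \<le> r * (\<Sum>u\<in>V. wdeg g u)"
      using r0 r by (intro mult_left_mono sum_mono) auto
    also have "\<dots> = (\<Sum>u\<in>V. deg u * (r * g u))"
      by (simp add: sum_deg_mult[symmetric] sum_distrib_left mult_ac)
    also have "\<dots> \<le> (\<Sum>u\<in>V. deg u * wdeg g u)"
      using r by (intro sum_mono mult_left_mono) (auto simp: wdeg_def intro!: sum_nonneg adj_nonneg)
    finally show ?thesis .
  qed
  have "0 \<le> b * S - b * (2 * (\<Sum>u\<in>V. deg u * wdeg g u)) + b * (X * (\<Sum>u\<in>V. deg u))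
      + P - X * C / 3"
  proof -
    have "(\<Sum>u\<in>V. \<Sum>v\<in>V. adj u v *
        (b * (wcodeg g u v - wdeg g u - wdeg g v + X)
        + codeg u v * wcodeg g u v - X * codeg u v / 3))
      = b * S - b * (\<Sum>u\<in>V. \<Sum>v\<in>V. adj u v * wdeg g u) - b * (\<Sum>u\<in>V. \<Sum>v\<in>V. adj u v * wdeg g v)
        + b * (\<Sum>u\<in>V. \<Sum>v\<in>V. adj u v * X) + P - X * C / 3"
      unfolding S_def P_def C_def sum_distrib_left[of _ _ V] sum_divide_distrib sum.distrib[symmetric]
        sum_subtractf[symmetric]
      by (intro sum.cong refl) (simp add: field_simps)
    also have "\<dots> = b * S - b * (2 * (\<Sum>u\<in>V. deg u * wdeg g u)) + b * (X * (\<Sum>u\<in>V. deg u))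
      + P - X * C / 3"
      unfolding sum_adj sum_adj' by (simp add: sum_distrib_left sum_distrib_right sum_negf mult_ac)
    finally show ?thesis using book_inequality[of g b, OF g b, folded X_def] by simp
  qed
  \<comment> \<open>Here \<open>3 * b \<le> r\<close> enters: \<open>b * S + P - X * C / 3\<close>
    is at most \<open>2 * b * S - (r - b) * S\<close>, hence nonpositive, and only degree terms
    remain.\<close>
  moreover have "2 * b * S \<le> (r - b) * S"
    using br S0 by (intro mult_right_mono) auto
  ultimately have "0 \<le> b * (X * (\<Sum>u\<in>V. deg u) - 2 * (\<Sum>u\<in>V. deg u * wdeg g u))"
    using tri P by (simp add: algebra_simps)
  hence "2 * (r\<^sup>2 * X) \<le> X * (\<Sum>u\<in>V. deg u)"
    using b0 wd by (simp add: zero_le_mult_iff)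
  hence "X * (2 * r\<^sup>2) \<le> X * (\<Sum>u\<in>V. deg u)" by (simp add: mult_ac)
  thus ?thesis using pos by (simp add: X_def)
qed

text \<open>With unit weights the codegree terms of \<open>book_inequality\<close> on an edge
  combine to \<open>c * (b + c - n / 3)\<close>, where \<open>c\<close> is the codegree and
  \<open>n\<close> is \<open>card V\<close>. This is nonpositive because
  \<open>c \<le> b \<le> n / 6\<close>.\<close>

lemma sum_deg_square_le:
  assumes b: "\<And>u v. u \<in> V \<Longrightarrow> v \<in> V \<Longrightarrow> E u v \<Longrightarrow> codeg u v \<le> b"
    and b0: "0 < b" and bn: "6 * b \<le> real (card V)"
  shows "2 * (\<Sum>u\<in>V. (deg u)\<^sup>2) \<le> card V * (\<Sum>u\<in>V. deg u)"
proof -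
  have "0 \<le> (\<Sum>u\<in>V. \<Sum>v\<in>V. adj u v *
    (b * (codeg u v - deg u - deg v + card V) + codeg u v * codeg u v - card V * codeg u v / 3))"
    using book_inequality[of "\<lambda>_. 1" b] b by simp
  also have "\<dots> \<le> (\<Sum>u\<in>V. \<Sum>v\<in>V. b * (card V * adj u v - adj u v * deg u - adj u v * deg v))"
  proof (intro sum_mono)
    fix u v assume uv: "u \<in> V" "v \<in> V"
    show "adj u v * (b * (codeg u v - deg u - deg v + card V) + codeg u v * codeg u v
        - card V * codeg u v / 3) \<le> b * (card V * adj u v - adj u v * deg u - adj u v * deg v)"
    proof (cases "E u v")
      case True
      have c0: "0 \<le> codeg u v" by (rule wcodeg_nonneg) simp
      have "codeg u v * (b + codeg u v - card V / 3) \<le> 0"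
        using b[OF uv True] bn by (intro mult_nonneg_nonpos c0) auto
      thus ?thesis using True by (simp add: adj_def algebra_simps)
    qed (simp add: adj_def)
  qed
  also have "\<dots> = b * (card V * (\<Sum>u\<in>V. \<Sum>v\<in>V. adj u v * 1) -
     (\<Sum>u\<in>V. \<Sum>v\<in>V. adj u v * deg u) - (\<Sum>u\<in>V. \<Sum>v\<in>V. adj u v * deg v))"
    by (simp add: sum_subtractf flip: sum_distrib_left)
  also have "\<dots> = b * (card V * (\<Sum>u\<in>V. deg u) - 2 * (\<Sum>u\<in>V. (deg u)\<^sup>2))"
    unfolding sum_adj sum_adj' by (simp add: power2_eq_square)
  finally show ?thesis using b0 by (simp add: zero_le_mult_iff)
qed

section \<open>From large degrees to a bipartite induced subgraph\<close>

lemma triangle_deg_le: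
  assumes b: "\<And>u v. u \<in> V \<Longrightarrow> v \<in> V \<Longrightarrow> E u v \<Longrightarrow> codeg u v \<le> b"
    and "u \<in> V" "v \<in> V" "w \<in> V" "E u v" "E v w" "E u w"
  shows "deg u + deg v + deg w \<le> real (card V) + 3 * b"
  using wcodeg_triple_ge[of "\<lambda>_. 1" u v w] b[of u v] b[of v w] b[of u w] assms(2-) by simp

lemma deg_eq_card: "deg u = card {w \<in> V. E u w}"
  using finite_V by (simp add: wdeg_def adj_def of_bool_def sum.If_cases Int_def)

lemma codeg_eq_card: "codeg u v = card {w \<in> V. E u w \<and> E v w}"
proof -
  have "codeg u v = (\<Sum>w\<in>V. if E u w \<and> E v w then 1 else 0)"
    unfolding wcodeg_def adj_def by (intro sum.cong) auto
  thus ?thesis using finite_V by (simp add: sum.If_cases Int_def)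
qed

text \<open>
  Pick a vertex \<open>u\<close> and put \<open>w\<close> into the class \<open>A\<close> if it has a common neighbour with \<open>u\<close>.
  An edge inside \<open>A\<close> closes a pentagon through \<open>u\<close>, and every vertex is adjacent to at most two
  of its five vertices; an edge outside \<open>A\<close> gives three disjoint neighbourhoods.
\<close>

lemma triangle_free_two_colouring:
  assumes tri: "\<And>u v w. u \<in> V \<Longrightarrow> v \<in> V \<Longrightarrow> w \<in> V \<Longrightarrow> E u v \<Longrightarrow> E v w \<Longrightarrow> E u w \<Longrightarrow> False"
    and deg: "\<And>u. u \<in> V \<Longrightarrow> 2 * real (card V) < 5 * deg u"
  shows "\<exists>A \<subseteq> V. \<forall>u\<in>V. \<forall>v\<in>V. E u v \<longrightarrow> (u \<in> A \<longleftrightarrow> v \<notin> A)"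
proof (cases "V = {}")
  case False
  then obtain u where u: "u \<in> V" by blast
  define A where "A = {w \<in> V. \<exists>x\<in>V. E u x \<and> E w x}"
  have "w \<in> A \<longleftrightarrow> z \<notin> A" if wz: "w \<in> V" "z \<in> V" "E w z" for w z
  proof -
    have False if "w \<in> A" "z \<in> A"
    proof -
      obtain x y where xy: "x \<in> V" "E u x" "E w x" "y \<in> V" "E u y" "E z y"
        using \<open>w \<in> A\<close> \<open>z \<in> A\<close> by (auto simp: A_def)
      \<comment> \<open>The five vertices may coincide: the count only uses that consecutive
        vertices of the closed walk \<open>u x w z y\<close> have no common neighbour.\<close>
      have "deg u + deg x + deg w + deg z + deg y =
          (\<Sum>v\<in>V. adj u v + adj x v + adj w v + adj z v + adj y v)"
        by (simp add: wdeg_def sum.distrib)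
      also have "\<dots> \<le> (\<Sum>v\<in>V. 2)"
      proof (intro sum_mono)
        fix v assume v: "v \<in> V"
        have no: "\<not> (E p v \<and> E q v)" if "p \<in> V" "q \<in> V" "E p q" for p q
          using tri[OF that(1,2) v that(3)] by blast
        show "adj u v + adj x v + adj w v + adj z v + adj y v \<le> 2"
          using no[of u x] no[of w x] no[of w z] no[of z y] no[of u y] xy wz u
          by (auto simp: adj_def of_bool_def)
      qed
      finally show False
        using deg[OF u] deg[OF xy(1)] deg[OF xy(4)] deg[OF wz(1)] deg[OF wz(2)] by simp
    qed
    moreover have False if "w \<notin> A" "z \<notin> A"
    proof -
      have "deg u + deg w + deg z = (\<Sum>v\<in>V. adj u v + adj w v + adj z v)"
        by (simp add: wdeg_def sum.distrib)
      also have "\<dots> \<le> (\<Sum>v\<in>V. 1)"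
        using that wz tri[OF wz(1,2) _ wz(3)]
        by (intro sum_mono) (auto simp: adj_def of_bool_def A_def)
      finally show False
        using deg[OF u] deg[OF wz(1)] deg[OF wz(2)] by simp
    qed
    ultimately show ?thesis by blast
  qed
  moreover have "A \<subseteq> V" by (auto simp: A_def)
  ultimately show ?thesis by blast
qed auto

lemma bipartite_core:
  fixes n :: nat and \<epsilon> :: real
  assumes n: "card V = n" "0 < n" and \<epsilon>: "0 < \<epsilon>" "\<epsilon> < 1 / 46"
    and b: "\<And>u v. u \<in> V \<Longrightarrow> v \<in> V \<Longrightarrow> E u v \<Longrightarrow> codeg u v \<le> (1 / 6 - 2 * \<epsilon>) * n"
    and e: "2 * (1 / 4 - \<epsilon> ^ 3) * (real n)\<^sup>2 \<le> (\<Sum>u\<in>V. deg u)"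
  obtains W A where "A \<subseteq> W" "W \<subseteq> V" "(1 - \<epsilon>) * n \<le> card W"
    "\<And>v. v \<in> W \<Longrightarrow> (1 / 2 - 2 * \<epsilon>) * n \<le> card {w \<in> W. E v w}"
    "\<And>u v. u \<in> W \<Longrightarrow> v \<in> W \<Longrightarrow> E u v \<Longrightarrow> u \<in> A \<longleftrightarrow> v \<notin> A"
proof -
  define L where "L = {v \<in> V. deg v < (1 / 2 - \<epsilon>) * n}"
  define W where "W = V - L"
  have finL: "finite L" and LV: "L \<subseteq> V" using finite_V by (auto simp: L_def)
  \<comment> \<open>A Chebyshev-type count: each vertex of \<open>L\<close> has degree more than
    \<open>\<epsilon> * n\<close> below \<open>n / 2\<close>.\<close>
  have "card L * (\<epsilon> * n)\<^sup>2 = (\<Sum>v\<in>L. (\<epsilon> * n)\<^sup>2)" by simp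
  also have "\<dots> \<le> (\<Sum>v\<in>L. (real n / 2 - deg v)\<^sup>2)"
    using \<epsilon> by (intro sum_mono power_mono) (auto simp: L_def algebra_simps)
  also have "\<dots> \<le> (\<Sum>v\<in>V. (real n / 2 - deg v)\<^sup>2)"
    by (intro sum_mono2 finite_V LV) auto
  also have "\<dots> = (\<Sum>v\<in>V. (deg v)\<^sup>2) - n * (\<Sum>v\<in>V. deg v) + real n ^ 3 / 4"
  proof -
    have "(\<Sum>v\<in>V. (real n / 2 - deg v)\<^sup>2) = (\<Sum>v\<in>V. (real n)\<^sup>2 / 4 - n * deg v + (deg v)\<^sup>2)"
      by (intro sum.cong refl) (simp add: power2_diff power_divide)
    thus ?thesis
      by (simp add: sum.distrib sum_subtractf n sum_distrib_left power2_eq_square power3_eq_cube)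
  qed
  \<comment> \<open>Bounding the squares by \<open>n / 2\<close> times the degree sum leaves
    \<open>n ^ 3 / 4\<close> minus \<open>n / 2\<close> times the degree sum; now \<open>e\<close>
    applies.\<close>
  also have "\<dots> \<le> \<epsilon> ^ 3 * real n ^ 3"
  proof -
    have "2 * (\<Sum>u\<in>V. (deg u)\<^sup>2) \<le> card V * (\<Sum>u\<in>V. deg u)"
      by (rule sum_deg_square_le[OF b]) (use n \<epsilon> in \<open>auto simp: algebra_simps\<close>)
    moreover have "n * (2 * (1 / 4 - \<epsilon> ^ 3) * (real n)\<^sup>2) \<le> n * (\<Sum>u\<in>V. deg u)"
      using e by (intro mult_left_mono) auto
    ultimately show ?thesis
      using n by (simp add: algebra_simps power2_eq_square power3_eq_cube)
  qed
  finally have "(\<epsilon> * n)\<^sup>2 * card L \<le> (\<epsilon> * n)\<^sup>2 * (\<epsilon> * n)"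
    by (simp add: power2_eq_square power3_eq_cube algebra_simps)
  hence cardL: "card L \<le> \<epsilon> * n" using n \<epsilon> by simp
  have cardW: "real (card W) = n - real (card L)"
    using card_Diff_subset[OF finL LV] card_mono[OF finite_V LV] n by (simp add: W_def of_nat_diff)
  have "W \<subseteq> V" by (auto simp: W_def)
  \<comment> \<open>The same relation on the smaller vertex set: \<open>W.deg\<close> counts
    neighbours inside \<open>W\<close>, while \<open>deg\<close> still counts them in
    \<open>V\<close>.\<close>
  interpret W: finite_symmetric_relation W E
    using finite_V sym by unfold_locales (auto simp: W_def)
  have degW: "(1 / 2 - 2 * \<epsilon>) * n \<le> W.deg v" if v: "v \<in> W" for v
  proof -
    have "deg v = W.deg v + (\<Sum>w\<in>L. adj v w)"
      using sum.subset_diff[OF LV finite_V, of "adj v"]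
      unfolding wdeg_def W.wdeg_def W_def[symmetric] by simp
    also have "(\<Sum>w\<in>L. adj v w) \<le> (\<Sum>w\<in>L. 1)" by (intro sum_mono) (simp add: adj_def)
    finally have "deg v \<le> W.deg v + card L" by simp
    moreover have "(1 / 2 - \<epsilon>) * n \<le> deg v" using v by (auto simp: W_def L_def)
    ultimately show ?thesis using cardL by (simp add: algebra_simps)
  qed
  have "\<exists>A \<subseteq> W. \<forall>u\<in>W. \<forall>v\<in>W. E u v \<longrightarrow> (u \<in> A \<longleftrightarrow> v \<notin> A)"
  proof (rule W.triangle_free_two_colouring)
    fix u v w assume uvw: "u \<in> W" "v \<in> W" "w \<in> W" "E u v" "E v w" "E u w"
    have "deg u + deg v + deg w \<le> card V + 3 * ((1 / 6 - 2 * \<epsilon>) * n)"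
      by (rule triangle_deg_le[OF b]) (use uvw in \<open>auto simp: W_def\<close>)
    \<comment> \<open>Both bounds on the degree sum of the triangle have leading term
      \<open>3 / 2 * n\<close>; the corrections \<open>- 3 * \<epsilon> * n\<close> and
      \<open>- 6 * \<epsilon> * n\<close> contradict each other.\<close>
    moreover have "(1 / 2 - \<epsilon>) * n \<le> deg z" if "z \<in> W" for z
      using that by (auto simp: W_def L_def)
    ultimately have "3 * ((1 / 2 - \<epsilon>) * n) \<le> card V + 3 * ((1 / 6 - 2 * \<epsilon>) * n)"
      using uvw by (smt (verit))
    hence "\<epsilon> * n \<le> 0" using n by (simp add: algebra_simps)
    thus False using n \<epsilon> by (simp add: mult_le_0_iff)
  next
    fix u assume "u \<in> W"
    have "2 * real (card W) \<le> 2 * n" using cardW by simp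
    also have "\<dots> < 5 * ((1 / 2 - 2 * \<epsilon>) * n)" using n \<epsilon> by (simp add: algebra_simps)
    finally show "2 * real (card W) < 5 * W.deg u" using degW[OF \<open>u \<in> W\<close>] by simp
  qed
  then obtain A where "A \<subseteq> W" "\<And>u v. u \<in> W \<Longrightarrow> v \<in> W \<Longrightarrow> E u v \<Longrightarrow> u \<in> A \<longleftrightarrow> v \<notin> A"
    by blast
  moreover have "(1 - \<epsilon>) * n \<le> card W" using cardW cardL by (simp add: algebra_simps)
  ultimately show ?thesis
    using that[of A W] degW[unfolded W.deg_eq_card] \<open>W \<subseteq> V\<close> by blast
qed

end

section \<open>Spectral radius, booksize and induced subgraphs of the graph\<close>

lemma graph_spectral_radius_weight:
  assumes "finite (pverts G)" "pverts G \<noteq> {}"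
  obtains g :: "'a \<Rightarrow> real" where "\<And>v. 0 \<le> g v" "0 < sum g (pverts G)"
    "\<And>v. v \<in> pverts G \<Longrightarrow> graph_spectral_radius G * g v \<le> sum g (nbhd G v)"
proof -
  obtain vs where vs: "distinct vs" "set vs = pverts G"
    using finite_distinct_list[OF assms(1)] by blast
  have "adjacency_matrix G vs \<in> carrier_mat (length vs) (length vs)"
    by (simp add: adjacency_matrix_def)
  moreover have "0 < length vs" using vs assms(2) by auto
  ultimately have "graph_spectral_radius G \<in> norm ` spectrum (adjacency_matrix G vs)"
    using spectral_radius_mem_max(1) graph_spectral_radius_eq[OF vs] by metis
  then obtain k where k: "eigenvalue (adjacency_matrix G vs) k" "graph_spectral_radius G = norm k"
    by (auto simp: spectrum_def)
  then obtain f where f: "\<exists>x\<in>pverts G. f x \<noteq> 0"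
    "\<And>x. x \<in> pverts G \<Longrightarrow> (\<Sum>y\<in>nbhd G x. f y) = k * f x"
    unfolding eigenvalue_adjacency_matrix_iff[OF vs] by blast
  have "0 < (\<Sum>x\<in>pverts G. norm (f x))"
    using f(1) assms(1) by (metis norm_ge_zero sum_pos2 zero_less_norm_iff)
  \<comment> \<open>Taking moduli in the eigenvector equation and applying the triangle inequality
    gives a real nonnegative weight.\<close>
  moreover have "graph_spectral_radius G * norm (f x) \<le> (\<Sum>y\<in>nbhd G x. norm (f y))"
    if "x \<in> pverts G" for x
    using norm_sum[of f "nbhd G x"] f(2)[OF that] by (simp add: k(2) norm_mult)
  ultimately show ?thesis using that[of "\<lambda>x. norm (f x)"] by simp
qed

lemma card_nbhd_Int_le_booksize:
  assumes "finite (parcs G)" "(u, v) \<in> parcs G"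
  shows "card (nbhd G u \<inter> nbhd G v) \<le> booksize G"
  using assms by (force simp: booksize_def intro!: Max_ge)

lemma out_degree_induced:
  assumes "W \<subseteq> pverts G" "v \<in> W"
  shows "out_degree (with_proj \<lparr>pverts = W, parcs = {(u, w) \<in> parcs G. u \<in> W \<and> w \<in> W}\<rparr>) v
    = card {w \<in> W. (v, w) \<in> parcs G}"
proof -
  have "out_arcs (with_proj \<lparr>pverts = W, parcs = {(u, w) \<in> parcs G. u \<in> W \<and> w \<in> W}\<rparr>) v
      = Pair v ` {w \<in> W. (v, w) \<in> parcs G}"
    using assms by (auto simp: out_arcs_def)
  thus ?thesis by (simp add: out_degree_def card_image inj_on_def)
qed

lemma induced_subgraph_restrict:
  assumes "pair_wf_digraph G" "W \<subseteq> pverts G"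
  shows "induced_subgraph
    (with_proj \<lparr>pverts = W, parcs = {(u, w) \<in> parcs G. u \<in> W \<and> w \<in> W}\<rparr>) (with_proj G)"
  using assms
  by (auto simp: induced_subgraph_def subgraph_def wf_digraph_wp_iff pair_wf_digraph_def)

theorem theorem4p2:
  fixes G :: "'a pair_pre_digraph" and n :: nat and \<alpha> :: real
  assumes "0 < \<alpha>" and "\<alpha> < 10 powi (-5)"
    and "pair_graph G" and "card (pverts G) = n"
    and "graph_spectral_radius G \<ge> (1 / 2 - \<alpha>) * real n"
  shows "real (booksize G) > (1 / 6 - 2 * \<alpha> powr (1 / 3)) * real n \<or>
    (\<exists>H :: 'a pair_pre_digraph.
        induced_subgraph (with_proj H) (with_proj G) \<and> bipartite H \<and>
        real (card (pverts H)) \<ge> (1 - \<alpha> powr (1 / 3)) * real n \<and>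
        real (min_degree H) \<ge> (1 / 2 - 4 * \<alpha> powr (1 / 3)) * real n)"
proof -
  interpret pair_graph G by fact
  let ?E = "\<lambda>u v. (u, v) \<in> parcs G"
  define restr where "restr W = \<lparr>pverts = W, parcs = {(u, w) \<in> parcs G. u \<in> W \<and> w \<in> W}\<rparr>" for W
  define \<epsilon> where "\<epsilon> = \<alpha> powr (1 / 3)"
  have \<epsilon>0: "0 < \<epsilon>" and \<alpha>: "\<alpha> = \<epsilon> ^ 3"
    using assms(1) by (auto simp: \<epsilon>_def powr_power)
  \<comment> \<open>Since \<open>46 ^ 3 = 97336 < 10 ^ 5\<close>. It suffices for the book bound to
    be positive (\<open>\<epsilon> < 1 / 12\<close>) and for the two-colouring
    (\<open>\<epsilon> < 1 / 20\<close>).\<close>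
  have \<epsilon>1: "\<epsilon> < 1 / 46"
  proof (rule power_less_imp_less_base)
    show "\<epsilon> ^ 3 < (1 / 46) ^ 3"
      using assms(2) unfolding \<alpha> by (simp add: power_int_def power_divide)
  qed simp
  interpret finite_symmetric_relation "pverts G" ?E
    using pair_finite_verts pair_sym_arcs by unfold_locales (auto simp: symmetric_def elim: symE)
  show ?thesis
  proof (cases "real (booksize G) > (1 / 6 - 2 * \<epsilon>) * n")
    case False
    have ex: "\<exists>H :: 'a pair_pre_digraph.
        induced_subgraph (with_proj H) (with_proj G) \<and> bipartite H \<and>
        real (card (pverts H)) \<ge> (1 - \<epsilon>) * real n \<and>
        real (min_degree H) \<ge> (1 / 2 - 4 * \<epsilon>) * real n"
    \<comment> \<open>Without vertices there is no eigenvector; the empty graph then meets all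
      bounds, which are 0.\<close>
    proof (cases "n = 0")
      case True
      have "induced_subgraph (with_proj (restr {})) (with_proj G)"
        unfolding restr_def by (rule induced_subgraph_restrict) auto
      moreover have "bipartite (restr {})" by (auto simp: bipartite_def restr_def)
      ultimately show ?thesis using True by auto
    next
      case n: False
      have b: "codeg u v \<le> (1 / 6 - 2 * \<epsilon>) * n" if "?E u v" for u v
      proof -
        have "codeg u v = card (nbhd G u \<inter> nbhd G v)"
          unfolding codeg_eq_card nbhd_def by (intro arg_cong[of _ _ "\<lambda>A. real (card A)"]) auto
        thus ?thesis
          using card_nbhd_Int_le_booksize[OF pair_finite_arcs that] False by linarith
      qed
      have "pverts G \<noteq> {}" using n assms(4) by auto
      then obtain g where g: "\<And>v. 0 \<le> g v" "0 < sum g (pverts G)"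
        "\<And>v. v \<in> pverts G \<Longrightarrow> graph_spectral_radius G * g v \<le> sum g (nbhd G v)"
        using graph_spectral_radius_weight[OF pair_finite_verts] by blast
      have e3: "\<epsilon> ^ 3 \<le> \<epsilon>" using \<epsilon>0 \<epsilon>1 power_decreasing[of 1 3 \<epsilon>] by simp
      \<comment> \<open>Expanding the square of \<open>1 / 2 - \<alpha>\<close> gives
        \<open>1 / 4 - \<alpha>\<close> plus a square, which is dropped.\<close>
      have "2 * (1 / 4 - \<epsilon> ^ 3) * (real n)\<^sup>2 \<le> 2 * ((1 / 2 - \<alpha>) * n)\<^sup>2"
      proof -
        have "2 * ((1 / 2 - \<alpha>) * n)\<^sup>2 = 2 * (1 / 4 - \<epsilon> ^ 3) * (real n)\<^sup>2 + 2 * (\<alpha> * n)\<^sup>2"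
          unfolding \<alpha>[symmetric] by (simp add: power2_eq_square algebra_simps)
        thus ?thesis by simp
      qed
      also have "\<dots> \<le> (\<Sum>u\<in>pverts G. deg u)"
      proof (rule edges_ge_square[of g "(1 / 6 - 2 * \<epsilon>) * n"])
        fix v assume v: "v \<in> pverts G"
        have "(1 / 2 - \<alpha>) * n * g v \<le> graph_spectral_radius G * g v"
          using assms(5) g(1) by (intro mult_right_mono) auto
        also have "\<dots> \<le> sum g (nbhd G v)" by (rule g(3)[OF v])
        also have "\<dots> = (\<Sum>w\<in>pverts G. if ?E v w then g w else 0)"
          using pair_finite_verts by (simp add: nbhd_def sum.inter_filter)
        also have "\<dots> = wdeg g v"
          unfolding wdeg_def adj_def by (rule sum.cong) auto
        finally show "(1 / 2 - \<alpha>) * n * g v \<le> wdeg g v" .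
      next
        \<comment> \<open>The first factor equals
          \<open>6 * \<epsilon> - \<epsilon> ^ 3\<close>.\<close>
        have "0 < (1 / 2 - \<alpha> - 3 * (1 / 6 - 2 * \<epsilon>)) * n"
          using n \<epsilon>0 e3 unfolding \<alpha> by (intro mult_pos_pos) auto
        thus "3 * ((1 / 6 - 2 * \<epsilon>) * n) \<le> (1 / 2 - \<alpha>) * n" by (simp add: algebra_simps)
      qed (use g b n \<epsilon>1 in auto)
      finally have e: "2 * (1 / 4 - \<epsilon> ^ 3) * (real n)\<^sup>2 \<le> (\<Sum>u\<in>pverts G. deg u)" .
      obtain W A where W: "A \<subseteq> W" "W \<subseteq> pverts G" "(1 - \<epsilon>) * n \<le> card W"
        "\<And>v. v \<in> W \<Longrightarrow> (1 / 2 - 2 * \<epsilon>) * n \<le> card {w \<in> W. ?E v w}"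
        "\<And>u v. u \<in> W \<Longrightarrow> v \<in> W \<Longrightarrow> ?E u v \<Longrightarrow> u \<in> A \<longleftrightarrow> v \<notin> A"
        by (rule bipartite_core[OF assms(4) _ \<epsilon>0 \<epsilon>1 b e]) (use n in auto)
      have "0 < (1 - \<epsilon>) * n" using n \<epsilon>1 by simp
      hence "W \<noteq> {}" using W(3) by auto
      moreover have finW: "finite W" using W(2) pair_finite_verts by (rule finite_subset)
      ultimately have "min_degree (restr W) \<in> out_degree (with_proj (restr W)) ` W"
        unfolding min_degree_def using Min_in[of "out_degree (with_proj (restr W)) ` W"]
        by (simp add: restr_def)
      then obtain v where v: "v \<in> W" "min_degree (restr W) = card {w \<in> W. ?E v w}"
        using out_degree_induced[OF W(2)] unfolding restr_def by auto
      have "(1 / 2 - 4 * \<epsilon>) * n \<le> (1 / 2 - 2 * \<epsilon>) * n"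
        using \<epsilon>0 by (intro mult_right_mono) auto
      hence "(1 / 2 - 4 * \<epsilon>) * n \<le> min_degree (restr W)"
        using W(4)[OF v(1)] v(2) by simp
      moreover have "bipartite (restr W)"
        unfolding bipartite_def
        by (rule exI[of _ A], rule exI[of _ "W - A"]) (use W in \<open>auto simp: restr_def\<close>)
      moreover have "induced_subgraph (with_proj (restr W)) (with_proj G)"
        unfolding restr_def using W(2) by (intro induced_subgraph_restrict) auto
      moreover have "pverts (restr W) = W" by (simp add: restr_def)
      ultimately show ?thesis using W(3) by (intro exI[of _ "restr W"]) simp
    qed
    thus ?thesis unfolding \<epsilon>_def by blast
  qed (simp add: \<epsilon>_def)
qed

end
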